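(* Let $G$ be a connected simple cubic graph of girth 4, let $M(G)$ be a $\Pi$-map of $G$, and let $\mu':V(G)\cup E(G)\to\{0,1,2,3\}$ be a periodic ETGC of $M(G)$ (obtained by the spray rule). Then $\mu'$ has an associated 3-permutation face coloring $\mu$ of $M(G)$ (assigning to the face with belt $B$ the 3-permutation $\mu(B)=abc$, where $0,a,b,c$ are the $\mu'$-colors of four consecutive vertices of $B$ in clockwise order starting at a vertex of color $0$) such that no two adjacent faces of $M(G)$ (i.e. faces sharing an edge) are assigned by $\mu$ the same 3-permutation.
   Context: Write $[3]_0=\{0,1,2,3\}$. $G$ is a connected simple cubic graph of girth 4. A set $S\subseteq V(G)$ is an efficient dominating set (EDS) if $|N_G[v]\cap S|=1$ for every $v\in V(G)$, where $N_G[v]$ is the closed neighborhood. A total coloring (TC) colors vertices and edges so that no two incident or adjacent elements get the same color. An efficient total coloring (ETC) of $G$ is a total coloring $\mu:V(G)\cup E(G)\to[3]_0$ such that for each vertex $v$ the restriction of $\mu$ to $N_G[v]$ is a bijection onto $[3]_0$, and the four vertex color classes partition $V(G)$ into EDSs. An ETGC (efficient total girth coloring) is an ETC in which every 4-cycle of $G$ has each of the four colors exactly once on its vertices and exactly once on its edges. A map $M(G)$ is an embedding of $G$ in a connected closed orientable surface $S$ of genus equal to the genus of $G$ such that the components of $S\setminus G$ are open disks; closures of these disks are the faces, and a belt is a face boundary cycle (an $\ell$-belt if it has length $\ell$). A vertex of $G$ in no 4-cycle of $G$ is a Y-vertex; an edge with both ends Y-vertices is a Y-edge. A $2\ell$-belt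 with consecutive edges $(e_1,\dots,e_{2\ell})$ is a Y-belt if its Y-edges, if any, occur only in opposite pairs $\{e_h,e_{h+\ell}\}$, $1\le h\le\ell$. $M(G)$ is a Y-map if all belts have even length and are Y-belts. A $\Pi$-map is a Y-map $M(G)$ for which $V(G)$ admits a partition into four EDSs, labelled $0,1,2,3$, such that the cyclic sequence of vertex colors of each $\ell$-belt has the form $(a,b,c,d)^{\ell/4}$ with $\{a,b,c,d\}=[3]_0$ (so all belt lengths are divisible by 4). An ETGC is periodic if for each belt, traversed in one of its two directions, the alternating cyclic sequence of colors (vertex, edge, vertex, edge, ...) is a concatenation of copies of $a,b,c,a,d,c,b,d$ for some $\{a,b,c,d\}=[3]_0$ (entries in odd positions being vertex colors and entries in even positions edge colors). Spray rule: at a vertex $v$ with incident edges $e=vv_e$, $f=vv_f$, $g=vv_g$: if $v,e,f$ have colors $c_0,c_1,c_2$, then $g$ gets the remaining color; and if moreover $v_e,v_f$ have colors $d_1,d_2$, then $v_g$ gets the color in $[3]_0\setminus\{c_0,d_1,d_2\}$. A 3-permutation is one of the six permutations $abc$ of $\{1,2,3\}$ written as a word. *)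

theory Defs
  imports
    "Graph_Theory.Graph_Theory"
    "HOL-Combinatorics.Orbits"
    "HOL-Combinatorics.Multiset_Permutations"
    "HOL-Library.Extended_Nat"
    "HOL-Library.Disjoint_Sets"
begin

text \<open>
  A finite simple graph is a \<open>pair_graph\<close>: the relation \<open>parcs G\<close> is finite, symmetric and
  irreflexive, so its elements are the darts (directed edges) of the graph, two for each
  undirected edge.  Undirected edges are two-element vertex sets.
\<close>

definition dart_edge :: "'a \<times> 'a \<Rightarrow> 'a set" where
  "dart_edge = (\<lambda>(u, v). {u, v})"

definition edges :: "'a pair_pre_digraph \<Rightarrow> 'a set set" where
  "edges G = dart_edge ` parcs G"

definition nbrs :: "'a pair_pre_digraph \<Rightarrow> 'a \<Rightarrow> 'a set" where
  "nbrs G v = {u. (v, u) \<in> parcs G}"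

definition closed_nbrs :: "'a pair_pre_digraph \<Rightarrow> 'a \<Rightarrow> 'a set" where
  "closed_nbrs G v = insert v (nbrs G v)"

definition cubic :: "'a pair_pre_digraph \<Rightarrow> bool" where
  "cubic G \<longleftrightarrow> (\<forall>v \<in> pverts G. out_degree G v = 3)"

text \<open>
  A cycle is the list of its vertices.  The library predicate \<open>pre_digraph.cycle\<close> is not used:
  it counts the closed walk along a dart and its reverse as a cycle of length 2.
\<close>

definition graph_cycle :: "'a pair_pre_digraph \<Rightarrow> 'a list \<Rightarrow> bool" where
  "graph_cycle G xs \<longleftrightarrow> 3 \<le> length xs \<and> distinct xs \<and>
     (\<forall>i < length xs. (xs ! i, xs ! (Suc i mod length xs)) \<in> parcs G)"

definition cycle_edges :: "'a list \<Rightarrow> 'a set set" where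
  "cycle_edges xs = (\<lambda>i. {xs ! i, xs ! (Suc i mod length xs)}) ` {..<length xs}"

definition girth :: "'a pair_pre_digraph \<Rightarrow> enat" where
  "girth G = (INF xs \<in> {xs. graph_cycle G xs}. enat (length xs))"

definition eds :: "'a pair_pre_digraph \<Rightarrow> 'a set \<Rightarrow> bool" where
  "eds G S \<longleftrightarrow> S \<subseteq> pverts G \<and> (\<forall>v \<in> pverts G. card (closed_nbrs G v \<inter> S) = 1)"

definition color_class :: "'a pair_pre_digraph \<Rightarrow> ('a \<Rightarrow> nat) \<Rightarrow> nat \<Rightarrow> 'a set" where
  "color_class G c i = {v \<in> pverts G. c v = i}"

definition eds_partition :: "'a pair_pre_digraph \<Rightarrow> ('a \<Rightarrow> nat) \<Rightarrow> bool" where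
  "eds_partition G c \<longleftrightarrow>
     partition_on (pverts G) (color_class G c ` {0..3}) \<and> (\<forall>i \<in> {0..3}. eds G (color_class G c i))"

text \<open>A coloring of vertices and edges is a function on the disjoint sum \<open>pverts G <+> edges G\<close>.\<close>

type_synonym 'a coloring = "'a + 'a set \<Rightarrow> nat"

definition vcol :: "'a coloring \<Rightarrow> 'a \<Rightarrow> nat" where
  "vcol \<mu> v = \<mu> (Inl v)"

definition ecol :: "'a coloring \<Rightarrow> 'a set \<Rightarrow> nat" where
  "ecol \<mu> e = \<mu> (Inr e)"

definition total_coloring :: "'a pair_pre_digraph \<Rightarrow> 'a coloring \<Rightarrow> bool" where
  "total_coloring G \<mu> \<longleftrightarrow>
     (\<forall>(u, v) \<in> parcs G. vcol \<mu> u \<noteq> vcol \<mu> v) \<and>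
     (\<forall>e \<in> edges G. \<forall>f \<in> edges G. e \<noteq> f \<and> e \<inter> f \<noteq> {} \<longrightarrow> ecol \<mu> e \<noteq> ecol \<mu> f) \<and>
     (\<forall>e \<in> edges G. \<forall>v \<in> e. vcol \<mu> v \<noteq> ecol \<mu> e)"

definition etc :: "'a pair_pre_digraph \<Rightarrow> 'a coloring \<Rightarrow> bool" where
  "etc G \<mu> \<longleftrightarrow>
     \<mu> ` (pverts G <+> edges G) \<subseteq> {0..3} \<and>
     total_coloring G \<mu> \<and>
     (\<forall>v \<in> pverts G. bij_betw (vcol \<mu>) (closed_nbrs G v) {0..3}) \<and>
     eds_partition G (vcol \<mu>)"

definition etgc :: "'a pair_pre_digraph \<Rightarrow> 'a coloring \<Rightarrow> bool" where
  "etgc G \<mu> \<longleftrightarrow> etc G \<mu> \<and>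
     (\<forall>xs. graph_cycle G xs \<and> length xs = 4 \<longrightarrow>
        bij_betw (vcol \<mu>) (set xs) {0..3} \<and> bij_betw (ecol \<mu>) (cycle_edges xs) {0..3})"

text \<open>In the spray rule, \<open>x\<close>, \<open>y\<close>, \<open>z\<close> are the three neighbors of \<open>v\<close>, in any order.\<close>

definition spray_rule :: "'a pair_pre_digraph \<Rightarrow> 'a coloring \<Rightarrow> bool" where
  "spray_rule G \<mu> \<longleftrightarrow>
     (\<forall>v \<in> pverts G. \<forall>x y z. distinct [x, y, z] \<and> nbrs G v = {x, y, z} \<longrightarrow>
        {0..3} - {vcol \<mu> v, ecol \<mu> {v, x}, ecol \<mu> {v, y}} = {ecol \<mu> {v, z}} \<and>
        {0..3} - {vcol \<mu> v, vcol \<mu> x, vcol \<mu> y} = {vcol \<mu> z})"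

text \<open>
  A cellular embedding of a connected graph in a connected closed oriented surface is given by
  its rotation system: \<open>rot v\<close> sends each neighbor of \<open>v\<close> to the next one in counterclockwise
  order around \<open>v\<close>.  The walk that leaves \<open>v\<close>, after arriving from \<open>u\<close>, towards \<open>rot v u\<close> keeps
  one and the same face on its right hand side, so it runs clockwise around that face.  The faces
  are the orbits of \<open>face_step\<close> on darts, and the belt of a face is the closed walk through its
  darts, which is thereby always listed in clockwise order.
\<close>

type_synonym 'a rotation = "'a \<Rightarrow> 'a \<Rightarrow> 'a"

definition rotation_system :: "'a pair_pre_digraph \<Rightarrow> 'a rotation \<Rightarrow> bool" where
  "rotation_system G rot \<longleftrightarrow> (\<forall>v \<in> pverts G. cyclic_on (rot v) (nbrs G v))"

definition face_step :: "'a rotation \<Rightarrow> 'a \<times> 'a \<Rightarrow> 'a \<times> 'a" where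
  "face_step rot = (\<lambda>(u, v). (v, rot v u))"

definition faces :: "'a pair_pre_digraph \<Rightarrow> 'a rotation \<Rightarrow> ('a \<times> 'a) set set" where
  "faces G rot = orbit (face_step rot) ` parcs G"

definition euler_characteristic :: "'a pair_pre_digraph \<Rightarrow> 'a rotation \<Rightarrow> int" where
  "euler_characteristic G rot =
     int (card (pverts G)) - int (card (edges G)) + int (card (faces G rot))"

definition embeds_in_genus :: "'a pair_pre_digraph \<Rightarrow> 'a rotation \<Rightarrow> nat \<Rightarrow> bool" where
  "embeds_in_genus G rot g \<longleftrightarrow> rotation_system G rot \<and> euler_characteristic G rot = 2 - 2 * int g"

definition graph_genus :: "'a pair_pre_digraph \<Rightarrow> nat" where
  "graph_genus G = (LEAST g. \<exists>rot. embeds_in_genus G rot g)"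

definition graph_map :: "'a pair_pre_digraph \<Rightarrow> 'a rotation \<Rightarrow> bool" where
  "graph_map G rot \<longleftrightarrow> embeds_in_genus G rot (graph_genus G)"

text \<open>The belt of a face, as the list of its darts starting at the dart \<open>d\<close> of the face.\<close>

definition belt :: "'a rotation \<Rightarrow> 'a \<times> 'a \<Rightarrow> ('a \<times> 'a) list" where
  "belt rot d = map (\<lambda>i. (face_step rot ^^ i) d) [0..<card (orbit (face_step rot) d)]"

definition belt_vertex_colors :: "('a \<Rightarrow> nat) \<Rightarrow> ('a \<times> 'a) list \<Rightarrow> nat list" where
  "belt_vertex_colors c ds = map (\<lambda>d. c (fst d)) ds"

definition belt_colors :: "'a coloring \<Rightarrow> ('a \<times> 'a) list \<Rightarrow> nat list" where
  "belt_colors \<mu> ds = concat (map (\<lambda>d. [vcol \<mu> (fst d), ecol \<mu> (dart_edge d)]) ds)"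

definition reverse_walk :: "('a \<times> 'a) list \<Rightarrow> ('a \<times> 'a) list" where
  "reverse_walk ds = map prod.swap (rev ds)"

definition adjacent_faces :: "('a \<times> 'a) set \<Rightarrow> ('a \<times> 'a) set \<Rightarrow> bool" where
  "adjacent_faces F F' \<longleftrightarrow> F \<noteq> F' \<and> dart_edge ` F \<inter> dart_edge ` F' \<noteq> {}"

definition Y_vertex :: "'a pair_pre_digraph \<Rightarrow> 'a \<Rightarrow> bool" where
  "Y_vertex G v \<longleftrightarrow> v \<in> pverts G \<and> \<not> (\<exists>xs. graph_cycle G xs \<and> length xs = 4 \<and> v \<in> set xs)"

definition Y_edge :: "'a pair_pre_digraph \<Rightarrow> 'a set \<Rightarrow> bool" where
  "Y_edge G e \<longleftrightarrow> e \<in> edges G \<and> (\<forall>v \<in> e. Y_vertex G v)"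

definition Y_belt :: "'a pair_pre_digraph \<Rightarrow> 'a set list \<Rightarrow> bool" where
  "Y_belt G es \<longleftrightarrow> even (length es) \<and>
     (\<forall>h < length es div 2. Y_edge G (es ! h) \<longleftrightarrow> Y_edge G (es ! (h + length es div 2)))"

definition Y_map :: "'a pair_pre_digraph \<Rightarrow> 'a rotation \<Rightarrow> bool" where
  "Y_map G rot \<longleftrightarrow> graph_map G rot \<and> (\<forall>d \<in> parcs G. Y_belt G (map dart_edge (belt rot d)))"

text \<open>
  The two color conditions below are stated for one starting dart of each belt.  They do not depend
  on it: moving the start along the belt only renames \<open>a1\<close>, \<open>a2\<close>, \<open>a3\<close>, \<open>a4\<close>.
\<close>

definition Pi_map :: "'a pair_pre_digraph \<Rightarrow> 'a rotation \<Rightarrow> bool" where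
  "Pi_map G rot \<longleftrightarrow> Y_map G rot \<and>
     (\<exists>c. eds_partition G c \<and>
       (\<forall>F \<in> faces G rot. \<exists>d \<in> F. \<exists>a1 a2 a3 a4 k. {a1, a2, a3, a4} = {0..3} \<and>
          belt_vertex_colors c (belt rot d) = concat (replicate k [a1, a2, a3, a4])))"

definition periodic :: "'a pair_pre_digraph \<Rightarrow> 'a rotation \<Rightarrow> 'a coloring \<Rightarrow> bool" where
  "periodic G rot \<mu> \<longleftrightarrow>
     (\<forall>F \<in> faces G rot. \<exists>d \<in> F. \<exists>ds \<in> {belt rot d, reverse_walk (belt rot d)}.
        \<exists>a1 a2 a3 a4 k. {a1, a2, a3, a4} = {0..3} \<and>
          belt_colors \<mu> ds = concat (replicate k [a1, a2, a3, a1, a4, a3, a2, a4]))"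

text \<open>
  The condition for all vertices of color 0 makes the 3-permutation of a face independent of the
  starting vertex; the existence of such a vertex makes it determined by \<open>\<mu>'\<close>.
\<close>

definition associated_face_coloring ::
    "'a pair_pre_digraph \<Rightarrow> 'a rotation \<Rightarrow> 'a coloring \<Rightarrow> (('a \<times> 'a) set \<Rightarrow> nat list) \<Rightarrow> bool" where
  "associated_face_coloring G rot \<mu>' \<mu> \<longleftrightarrow>
     (\<forall>F \<in> faces G rot.
        \<mu> F \<in> permutations_of_set {1, 2, 3} \<and>
        (\<exists>d \<in> F. vcol \<mu>' (fst d) = 0) \<and>
        (\<forall>d \<in> F. vcol \<mu>' (fst d) = 0 \<longrightarrow>
           map (\<lambda>i. vcol \<mu>' (fst ((face_step rot ^^ i) d))) [0..<4] = 0 # \<mu> F))"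

end

theory Submission
  imports Defs
begin

text \<open>
  Along the boundary of a face, periodicity of the total coloring makes the vertex colors a
  4-periodic sequence in which each of the four colors occurs once per period
  (\<open>periodic_face_colors\<close>). Hence the color of a vertex of the face determines the colors of all
  later vertices of the clockwise walk (\<open>same_color_same_continuation\<close>). In particular, the three
  colors following a vertex of color 0 do not depend on that vertex, so they define the
  3-permutation of the face, and two faces with the same 3-permutation have the same
  successor function on colors.

  Let two distinct faces share the edge \<open>uv\<close>. One of them contains the dart \<open>(u, v)\<close> and the other
  one the dart \<open>(v, u)\<close>, which is followed by \<open>(u, w)\<close> with \<open>w = rot u v\<close>. So the successor of the
  color of \<open>u\<close> is the color of \<open>v\<close> in the first face and the color of \<open>w\<close> in the second.
  Since \<open>u\<close> has more than one neighbor, \<open>w \<noteq> v\<close>; and distinct neighbors of \<open>u\<close> have distinct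
  colors. The two 3-permutations therefore differ.
\<close>

section \<open>Periodic words\<close>

lemma nth_concat_replicate:
  "i < k * length xs \<Longrightarrow> concat (replicate k xs) ! i = xs ! (i mod length xs)"
proof (induction k arbitrary: i)
  case (Suc k)
  show ?case
  proof (cases "i < length xs")
    case False
    then have "i - length xs < k * length xs" "(i - length xs) mod length xs = i mod length xs"
      using Suc.prems by (auto simp: mod_if[of i])
    with False show ?thesis using Suc.IH[of "i - length xs"] by (simp add: nth_append)
  qed (simp add: nth_append)
qed simp

lemma complement_mod_4:
  fixes x y :: nat
  assumes "(x + y) mod 4 = 0" "x < 4" "y < 4"
  shows "x = (4 - y) mod 4"
proof -
  define q where "q = (x + y) div 4"
  have q: "x + y = 4 * q" using mult_div_mod_eq[of 4 "x + y"] assms(1) by (simp add: q_def)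
  with assms(2,3) have "q = 0 \<or> q = 1" by linarith
  then show ?thesis
  proof
    assume "q = 1"
    with q have "x = 4 - y" by simp
    with assms(2) show ?thesis by simp
  qed (use q in simp)
qed

lemma length_belt_colors: "length (belt_colors \<mu> ds) = 2 * length ds"
  by (induction ds) (auto simp: belt_colors_def)

lemma nth_belt_colors_even:
  "i < length ds \<Longrightarrow> belt_colors \<mu> ds ! (2 * i) = vcol \<mu> (fst (ds ! i))"
proof (induction ds arbitrary: i)
  case (Cons d ds)
  show ?case
  proof (cases i)
    case (Suc j)
    with Cons show ?thesis by (simp add: belt_colors_def)
  qed (simp add: belt_colors_def)
qed simp

text \<open>The vertex colors are the entries of the alternating sequence at even indices.\<close>

lemma periodic_belt_vertex_colors:
  assumes "belt_colors \<mu> ds = concat (replicate k [a1, a2, a3, a1, a4, a3, a2, a4])"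
  shows "length ds = 4 * k"
    and "i < length ds \<Longrightarrow> vcol \<mu> (fst (ds ! i)) = [a1, a3, a4, a2] ! (i mod 4)"
proof -
  have "2 * length ds = 8 * k"
    using arg_cong[OF assms, of length]
    by (simp add: length_belt_colors length_concat sum_list_replicate)
  then show len: "length ds = 4 * k" by simp
  assume i: "i < length ds"
  have "(2 * i) mod 8 = 2 * (i mod 4)"
    using mult_mod_right[of 2 i 4] by simp
  moreover have "i mod 4 \<in> {0, 1, 2, 3}" by auto
  ultimately show "vcol \<mu> (fst (ds ! i)) = [a1, a3, a4, a2] ! (i mod 4)"
    using nth_belt_colors_even[OF i, of \<mu>] assms i len
      nth_concat_replicate[of "2 * i" k "[a1, a2, a3, a1, a4, a3, a2, a4]"]
    by auto
qed

section \<open>Faces as orbits of darts\<close>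

lemma funpow_card_orbit:
  assumes "x \<in> orbit f x"
  shows "(f ^^ card (orbit f x)) x = x"
proof -
  have "card (orbit f x) = funpow_dist1 f x x"
    using inj_on_funpow_dist1[OF assms] orbit_conv_funpow_dist1[OF assms]
    by (metis card_atLeastLessThan card_image diff_zero)
  then show ?thesis using funpow_dist1_prop[OF assms] by simp
qed

lemma inj_on_finite_self_in_orbit:
  assumes "finite S" "inj_on f S" "f ` S \<subseteq> S" "x \<in> S"
  shows "x \<in> orbit f x"
proof -
  let ?g = "perm_restrict f S"
  have "inj_on ?g S" using assms(2) by (simp add: perm_restrict_def inj_on_def)
  moreover have "?g ` S \<subseteq> S" using assms(3) by (auto simp: perm_restrict_def)
  ultimately have "bij_betw ?g S S"
    using assms(1) by (simp add: bij_betw_def endo_inj_surj)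
  then have "?g permutes S"
    by (rule bij_imp_permutes) (simp add: perm_restrict_def)
  then have "x \<in> orbit ?g x"
    using assms(1) permutation_self_in_orbit permutation_permutes by metis
  moreover have "orbit f x = orbit ?g x"
    by (rule orbit_cong0[OF assms(4)]) (use assms(3) in \<open>auto simp: perm_restrict_def\<close>)
  ultimately show ?thesis by simp
qed

lemma parcs_sym:
  assumes "pair_graph G" "(u, v) \<in> parcs G"
  shows "(v, u) \<in> parcs G"
proof -
  interpret pair_graph G by fact
  show ?thesis using assms(2) by (rule arcs_symmetric)
qed

lemma dart_end_in_pverts:
  assumes "pair_graph G" "(u, v) \<in> parcs G"
  shows "v \<in> pverts G"
proof -
  interpret pair_graph G by fact
  show ?thesis using assms(2) by (rule in_arcsD2)
qed

lemma rot_nbr: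
  assumes "rotation_system G rot" "v \<in> pverts G" "u \<in> nbrs G v"
  shows "rot v u \<in> nbrs G v"
  using assms by (auto simp: rotation_system_def intro: cyclic_on_inI)

lemma face_step_in_parcs:
  assumes G: "pair_graph G" and rot: "rotation_system G rot" and d: "d \<in> parcs G"
  shows "face_step rot d \<in> parcs G"
proof -
  obtain u v where uv: "d = (u, v)" by (cases d)
  then have "rot v u \<in> nbrs G v"
    using rot_nbr[OF rot dart_end_in_pverts[OF G]] parcs_sym[OF G] d by (simp add: nbrs_def)
  then show ?thesis by (simp add: uv face_step_def nbrs_def)
qed

text \<open>
  Each \<open>rot v\<close> permutes the neighbors of \<open>v\<close>, so \<open>face_step\<close> permutes the finitely many darts.
\<close>

lemma face_step_self_in_orbit:
  assumes G: "pair_graph G" and rot: "rotation_system G rot" and d: "d \<in> parcs G"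
  shows "d \<in> orbit (face_step rot) d"
proof (rule inj_on_finite_self_in_orbit[OF _ _ _ d])
  interpret pair_graph G by fact
  show "finite (parcs G)" by (rule pair_finite_arcs)
  have inj_rot: "inj_on (rot v) (nbrs G v)" if "v \<in> pverts G" for v
  proof -
    have cyc: "cyclic_on (rot v) (nbrs G v)" using rot that by (simp add: rotation_system_def)
    have "rot v ` nbrs G v = nbrs G v"
    proof
      show "rot v ` nbrs G v \<subseteq> nbrs G v" using cyc by (auto intro: cyclic_on_inI)
      show "nbrs G v \<subseteq> rot v ` nbrs G v"
      proof
        fix y assume "y \<in> nbrs G v"
        then have y: "nbrs G v = orbit (rot v) y" using cyc by (simp add: cyclic_on_alldef)
        with \<open>y \<in> nbrs G v\<close> have "y \<in> orbit (rot v) y" by simp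
        then show "y \<in> rot v ` nbrs G v"
          by (cases rule: orbit.cases) (use y \<open>y \<in> nbrs G v\<close> in auto)
      qed
    qed
    then show ?thesis using finite_cyclic_on[OF cyc] by (simp add: eq_card_imp_inj_on)
  qed
  show "inj_on (face_step rot) (parcs G)"
  proof (rule inj_onI)
    fix x y assume x: "x \<in> parcs G" and y: "y \<in> parcs G"
      and eq: "face_step rot x = face_step rot y"
    obtain u v u' v' where xy: "x = (u, v)" "y = (u', v')" by (metis surj_pair)
    with eq have "v = v'" "rot v u = rot v u'" by (auto simp: face_step_def)
    moreover have "u \<in> nbrs G v" "u' \<in> nbrs G v" "v \<in> pverts G"
      using x y xy \<open>v = v'\<close> parcs_sym[OF G] dart_end_in_pverts[OF G] by (auto simp: nbrs_def)
    ultimately show "x = y" using inj_rot[of v] xy by (auto dest: inj_onD)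
  qed
  show "face_step rot ` parcs G \<subseteq> parcs G" using face_step_in_parcs[OF G rot] by blast
qed

lemma cyclic_on_face:
  assumes "pair_graph G" "rotation_system G rot" "F \<in> faces G rot"
  shows "cyclic_on (face_step rot) F"
  using assms face_step_self_in_orbit unfolding faces_def cyclic_on_def by fastforce

lemma face_eq_orbit:
  assumes "pair_graph G" "rotation_system G rot" "F \<in> faces G rot" "d \<in> F"
  shows "F = orbit (face_step rot) d"
  using orbit_cyclic_eq3[OF cyclic_on_face[OF assms(1-3)] assms(4)] by simp

lemma face_reach:
  assumes "pair_graph G" "rotation_system G rot" "F \<in> faces G rot" "d \<in> F" "d' \<in> F"
  obtains n where "d' = (face_step rot ^^ n) d"
  using face_eq_orbit[OF assms(1-4)] assms(5) by (auto simp: orbit_altdef)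

lemma face_subset_parcs:
  assumes G: "pair_graph G" and rot: "rotation_system G rot" and F: "F \<in> faces G rot"
  shows "F \<subseteq> parcs G"
proof -
  obtain d where d: "d \<in> parcs G" "F = orbit (face_step rot) d"
    using F by (auto simp: faces_def)
  have "e \<in> parcs G" if "e \<in> orbit (face_step rot) d" for e
    using that by induction (simp_all add: face_step_in_parcs[OF G rot] d(1))
  then show ?thesis using d(2) by blast
qed

section \<open>Vertex colors around a face\<close>

text \<open>
  The period of the alternating color sequence has length 8, so the vertex colors have period 4. If
  the sequence is read counterclockwise, \<open>\<sigma>\<close> lists the period backwards.
\<close>

lemma periodic_face_colors:
  assumes G: "pair_graph G" and rot: "rotation_system G rot" and per: "periodic G rot \<mu>"
    and F: "F \<in> faces G rot"
  obtains d \<sigma> where "d \<in> F" "bij_betw \<sigma> {..<4::nat} {0..3::nat}"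
    "\<And>n. vcol \<mu> (fst ((face_step rot ^^ n) d)) = \<sigma> (n mod 4)"
proof -
  obtain d ds a1 a2 a3 a4 k where d: "d \<in> F" and ds: "ds \<in> {belt rot d, reverse_walk (belt rot d)}"
    and a: "{a1, a2, a3, a4} = {0..3}"
    and col: "belt_colors \<mu> ds = concat (replicate k [a1, a2, a3, a1, a4, a3, a2, a4])"
    using bspec[OF per[unfolded periodic_def] F] by (elim bexE exE conjE)
  let ?f = "face_step rot" and ?A = "[a1, a3, a4, a2]"
  let ?c = "\<lambda>n. vcol \<mu> (fst ((?f ^^ n) d))"
  define N where "N = card (orbit ?f d)"
  have self: "d \<in> orbit ?f d" using face_eq_orbit[OF G rot F d] d by simp
  then have "0 < N" using finite_orbit[OF self] by (auto simp: N_def card_gt_0_iff)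
  have c_mod: "?c n = ?c (n mod N)" for n
    using funpow_mod_eq[OF funpow_card_orbit[OF self], of n] by (simp add: N_def)
  have len: "length ds = N" using ds by (auto simp: belt_def reverse_walk_def N_def)
  note N = periodic_belt_vertex_colors(1)[OF col, unfolded len]
  note nth = periodic_belt_vertex_colors(2)[OF col, unfolded len]
  have set4: "{..<4::nat} = {0, 1, 2, 3}" by auto
  have bij: "bij_betw \<sigma> {..<4::nat} {0..3::nat}" if "\<sigma> ` {..<4} = {a1, a2, a3, a4}" for \<sigma>
    using that a by (simp add: bij_betw_def eq_card_imp_inj_on)
  show thesis
  proof (cases "ds = belt rot d")
    case True
    have "?c n = ?A ! (n mod 4)" for n
    proof -
      have "n mod N < N" using \<open>0 < N\<close> by simp
      then have "?c (n mod N) = ?A ! (n mod N mod 4)"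
        using nth[of "n mod N"] True by (simp add: belt_def N_def)
      then show ?thesis using c_mod[of n] N by (simp add: mod_mod_cancel)
    qed
    moreover have "(\<lambda>i. ?A ! i) ` {..<4} = {a1, a2, a3, a4}" unfolding set4 by auto
    ultimately show thesis using that[OF d bij] by blast
  next
    case False
    then have rev: "ds = reverse_walk (belt rot d)" using ds by simp
    \<comment> \<open>Reversing the walk exchanges the ends of each dart, hence the shift from \<open>N - 1 - i\<close> to \<open>N - i\<close>.\<close>
    have c_rev: "?c (N - i) = ?A ! (i mod 4)" if "i < N" for i
    proof -
      have "ds ! i = prod.swap ((?f ^^ (N - Suc i)) d)"
        using that by (simp add: rev reverse_walk_def belt_def N_def[symmetric] rev_nth)
      moreover have "fst ((?f ^^ Suc m) d) = snd ((?f ^^ m) d)" for m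
        by (simp add: face_step_def case_prod_beta)
      moreover have "Suc (N - Suc i) = N - i" using that by simp
      ultimately have "fst (ds ! i) = fst ((?f ^^ (N - i)) d)" by (metis fst_swap)
      then show ?thesis using nth[OF that] by simp
    qed
    have "?c n = ?A ! ((4 - n mod 4) mod 4)" for n
    proof (cases "n mod N = 0")
      case True
      then have "?c n = ?A ! 0" using c_mod[of n] c_mod[of N] c_rev[of 0] \<open>0 < N\<close> by simp
      moreover have "n mod 4 = 0" using True N by auto
      ultimately show ?thesis by simp
    next
      case False
      define m where "m = n mod N"
      have m: "0 < m" "m < N" using False \<open>0 < N\<close> by (auto simp: m_def)
      have "?c n = ?A ! ((N - m) mod 4)"
        using c_mod[of n] c_rev[of "N - m"] m by (simp add: m_def)
      moreover have "(N - m) mod 4 = (4 - m mod 4) mod 4"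
      proof -
        have "((N - m) mod 4 + m mod 4) mod 4 = 0" using m N by (simp add: mod_add_eq)
        then show ?thesis by (intro complement_mod_4) auto
      qed
      moreover have "m mod 4 = n mod 4" using N by (simp add: m_def mod_mod_cancel)
      ultimately show ?thesis by simp
    qed
    moreover have "(\<lambda>i. ?A ! ((4 - i) mod 4)) ` {..<4} = {a1, a2, a3, a4}"
      unfolding set4 by auto
    ultimately show thesis using that[OF d bij] by blast
  qed
qed

context
  fixes G :: "'a pair_pre_digraph" and rot :: "'a rotation" and \<mu> :: "'a coloring"
    and F :: "('a \<times> 'a) set"
  assumes G: "pair_graph G" and rot: "rotation_system G rot" and per: "periodic G rot \<mu>"
    and F: "F \<in> faces G rot"
begin

lemma same_color_same_continuation:
  assumes d: "d \<in> F" and d': "d' \<in> F" and eq: "vcol \<mu> (fst d) = vcol \<mu> (fst d')"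
  shows "vcol \<mu> (fst ((face_step rot ^^ i) d)) = vcol \<mu> (fst ((face_step rot ^^ i) d'))"
proof -
  obtain e \<sigma> where e: "e \<in> F" and bij: "bij_betw \<sigma> {..<4::nat} {0..3::nat}"
    and col: "\<And>n. vcol \<mu> (fst ((face_step rot ^^ n) e)) = \<sigma> (n mod 4)"
    using periodic_face_colors[OF G rot per F] by blast
  obtain m m' where m: "d = (face_step rot ^^ m) e" and m': "d' = (face_step rot ^^ m') e"
    using face_reach[OF G rot F e] d d' by metis
  have "\<sigma> (m mod 4) = \<sigma> (m' mod 4)" using eq by (simp add: m m' col)
  then have "m mod 4 = m' mod 4" using bij by (auto simp: bij_betw_def dest: inj_onD)
  then have "(i + m) mod 4 = (i + m') mod 4" by (metis mod_add_right_eq)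
  then show ?thesis
    using col[of "i + m"] col[of "i + m'"] by (simp add: m m' funpow_add)
qed

lemma face_colors_mod_4:
  assumes d: "d \<in> F"
  shows "vcol \<mu> (fst ((face_step rot ^^ i) d)) = vcol \<mu> (fst ((face_step rot ^^ (i mod 4)) d))"
proof -
  obtain e \<sigma> where e: "e \<in> F"
    and col: "\<And>n. vcol \<mu> (fst ((face_step rot ^^ n) e)) = \<sigma> (n mod 4)"
    using periodic_face_colors[OF G rot per F] by blast
  obtain m where m: "d = (face_step rot ^^ m) e" using face_reach[OF G rot F e d] by blast
  have "(i + m) mod 4 = (i mod 4 + m) mod 4" by (simp add: mod_add_left_eq)
  then show ?thesis
    using col[of "i + m"] col[of "i mod 4 + m"] by (simp add: m funpow_add)
qed

lemma face_has_color_0: "\<exists>d \<in> F. vcol \<mu> (fst d) = 0"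
proof -
  obtain e \<sigma> where e: "e \<in> F" and bij: "bij_betw \<sigma> {..<4::nat} {0..3::nat}"
    and col: "\<And>n. vcol \<mu> (fst ((face_step rot ^^ n) e)) = \<sigma> (n mod 4)"
    using periodic_face_colors[OF G rot per F] by blast
  have "0 \<in> \<sigma> ` {..<4}" using bij by (simp add: bij_betw_def)
  then obtain j where "j < 4" "\<sigma> j = 0" by auto
  moreover have "(face_step rot ^^ j) e \<in> F"
    by (rule cyclic_on_funpow_in[OF cyclic_on_face[OF G rot F] e])
  ultimately show ?thesis using col[of j] by (intro bexI) auto
qed

lemma four_consecutive_colors:
  assumes d: "d \<in> F"
  shows "bij_betw (\<lambda>i. vcol \<mu> (fst ((face_step rot ^^ i) d))) {..<4} {0..3}"
proof -
  obtain e \<sigma> where e: "e \<in> F" and bij: "bij_betw \<sigma> {..<4::nat} {0..3::nat}"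
    and col: "\<And>n. vcol \<mu> (fst ((face_step rot ^^ n) e)) = \<sigma> (n mod 4)"
    using periodic_face_colors[OF G rot per F] by blast
  obtain m where m: "d = (face_step rot ^^ m) e" using face_reach[OF G rot F e d] by blast
  have "inj_on (\<lambda>i. (i + m) mod 4) {..<4::nat}"
  proof (rule inj_onI)
    fix i j :: nat
    assume "i \<in> {..<4}" "j \<in> {..<4}" and eq: "(i + m) mod 4 = (j + m) mod 4"
    then have "i \<in> {0, 1, 2, 3}" "j \<in> {0, 1, 2, 3}" "m mod 4 \<in> {0, 1, 2, 3}" by auto
    moreover have "(i + m mod 4) mod 4 = (j + m mod 4) mod 4" using eq by (simp add: mod_add_right_eq)
    ultimately show "i = j" by auto
  qed
  moreover have "(\<lambda>i. (i + m) mod 4) ` {..<4::nat} \<subseteq> {..<4}" by auto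
  ultimately have "bij_betw (\<lambda>i. (i + m) mod 4) {..<4::nat} {..<4}"
    by (simp add: bij_betw_def endo_inj_surj)
  from bij_betw_trans[OF this bij]
  have "bij_betw (\<lambda>i. \<sigma> ((i + m) mod 4)) {..<4} {0..3}" by (simp add: comp_def)
  moreover have "vcol \<mu> (fst ((face_step rot ^^ i) d)) = \<sigma> ((i + m) mod 4)" for i
    using col[of "i + m"] by (simp add: m funpow_add)
  ultimately show ?thesis by simp
qed

end

section \<open>The face coloring\<close>

text \<open>
  The colors of the three vertices that follow a vertex of color 0 in the clockwise walk around
  the face. The vertex of color 0 is an arbitrary choice, immaterial for periodic colorings.
\<close>

definition face_word :: "'a rotation \<Rightarrow> 'a coloring \<Rightarrow> ('a \<times> 'a) set \<Rightarrow> nat list" where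
  "face_word rot \<mu> F =
     (let d = SOME d. d \<in> F \<and> vcol \<mu> (fst d) = 0
      in map (\<lambda>i. vcol \<mu> (fst ((face_step rot ^^ i) d))) [1..<4])"

lemma face_word_from_color_0:
  assumes "pair_graph G" "rotation_system G rot" "periodic G rot \<mu>" "F \<in> faces G rot"
    and d: "d \<in> F" "vcol \<mu> (fst d) = 0"
  shows "map (\<lambda>i. vcol \<mu> (fst ((face_step rot ^^ i) d))) [0..<4] = 0 # face_word rot \<mu> F"
proof -
  define e where "e = (SOME d. d \<in> F \<and> vcol \<mu> (fst d) = 0)"
  have e: "e \<in> F \<and> vcol \<mu> (fst e) = 0" unfolding e_def by (rule someI[of _ d]) (use d in simp)
  then have "vcol \<mu> (fst ((face_step rot ^^ i) d)) = vcol \<mu> (fst ((face_step rot ^^ i) e))" for i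
    using same_color_same_continuation[OF assms(1-4) d(1)] d(2) by simp
  moreover have "[0..<4] = 0 # [1..<4]" by (simp add: upt_rec)
  ultimately show ?thesis using e by (simp add: face_word_def e_def[symmetric] Let_def)
qed

lemma associated_face_coloring_face_word:
  assumes "pair_graph G" "rotation_system G rot" "periodic G rot \<mu>"
  shows "associated_face_coloring G rot \<mu> (face_word rot \<mu>)"
  unfolding associated_face_coloring_def
proof (intro ballI conjI impI)
  fix F assume F: "F \<in> faces G rot"
  show ex: "\<exists>d \<in> F. vcol \<mu> (fst d) = 0" by (rule face_has_color_0[OF assms F])
  show "map (\<lambda>i. vcol \<mu> (fst ((face_step rot ^^ i) d))) [0..<4] = 0 # face_word rot \<mu> F"
    if "d \<in> F" "vcol \<mu> (fst d) = 0" for d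
    by (rule face_word_from_color_0[OF assms F that])
  from ex obtain d where d: "d \<in> F" "vcol \<mu> (fst d) = 0" by blast
  let ?w = "map (\<lambda>i. vcol \<mu> (fst ((face_step rot ^^ i) d))) [0..<4]"
  have "distinct ?w" "set ?w = {0..3}"
    using four_consecutive_colors[OF assms F d(1)]
    by (auto simp: distinct_map bij_betw_def atLeast0LessThan)
  then have *: "distinct (0 # face_word rot \<mu> F)" "set (0 # face_word rot \<mu> F) = {0..3}"
    unfolding face_word_from_color_0[OF assms F d] by auto
  then have "set (face_word rot \<mu> F) = {0..3} - {0}" by auto
  also have "\<dots> = {1, 2, 3}" by auto
  finally show "face_word rot \<mu> F \<in> permutations_of_set {1, 2, 3}"
    using * by (simp add: permutations_of_set_def)
qed

text \<open>
  Every dart of a face is reached from one whose tail has color 0. Equal 3-permutations give equal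
  colors along both walks, first for four steps and then, by 4-periodicity, for all of them.
\<close>

lemma face_word_determines_successor:
  assumes "pair_graph G" "rotation_system G rot" "periodic G rot \<mu>"
    and F: "F \<in> faces G rot" "d \<in> F" and F': "F' \<in> faces G rot" "d' \<in> F'"
    and word: "face_word rot \<mu> F = face_word rot \<mu> F'"
    and eq: "vcol \<mu> (fst d) = vcol \<mu> (fst d')"
  shows "vcol \<mu> (snd d) = vcol \<mu> (snd d')"
proof -
  let ?f = "face_step rot"
  obtain z where z: "z \<in> F" "vcol \<mu> (fst z) = 0"
    using face_has_color_0[OF assms(1-3) F(1)] by blast
  obtain z' where z': "z' \<in> F'" "vcol \<mu> (fst z') = 0"
    using face_has_color_0[OF assms(1-3) F'(1)] by blast
  have words: "map (\<lambda>i. vcol \<mu> (fst ((?f ^^ i) z))) [0..<4]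
      = map (\<lambda>i. vcol \<mu> (fst ((?f ^^ i) z'))) [0..<4]"
    using face_word_from_color_0[OF assms(1-3) F(1) z]
      face_word_from_color_0[OF assms(1-3) F'(1) z'] word by simp
  have same: "vcol \<mu> (fst ((?f ^^ i) z)) = vcol \<mu> (fst ((?f ^^ i) z'))" for i
  proof -
    have "i mod 4 \<in> set [0..<4]" by simp
    then have "vcol \<mu> (fst ((?f ^^ (i mod 4)) z)) = vcol \<mu> (fst ((?f ^^ (i mod 4)) z'))"
      using words unfolding map_eq_conv by blast
    then show ?thesis
      using face_colors_mod_4[OF assms(1-3) F(1) z(1), of i]
        face_colors_mod_4[OF assms(1-3) F'(1) z'(1), of i] by simp
  qed
  obtain j where j: "d = (?f ^^ j) z" using face_reach[OF assms(1,2) F(1) z(1) F(2)] by blast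
  have "(?f ^^ j) z' \<in> F'"
    by (rule cyclic_on_funpow_in[OF cyclic_on_face[OF assms(1,2) F'(1)] z'(1)])
  moreover have "vcol \<mu> (fst d') = vcol \<mu> (fst ((?f ^^ j) z'))" using eq same[of j] by (simp add: j)
  ultimately have "vcol \<mu> (fst ((?f ^^ 1) d')) = vcol \<mu> (fst ((?f ^^ 1) ((?f ^^ j) z')))"
    using same_color_same_continuation[OF assms(1-3) F'(1) F'(2)] by blast
  also have "\<dots> = vcol \<mu> (fst ((?f ^^ 1) d))" using same[of "Suc j"] by (simp add: j)
  finally show ?thesis by (simp add: face_step_def case_prod_beta)
qed

section \<open>Adjacent faces\<close>

lemma adjacent_faces_opposite_darts:
  assumes "pair_graph G" "rotation_system G rot" "F \<in> faces G rot" "F' \<in> faces G rot"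
    and adj: "adjacent_faces F F'"
  obtains u v where "(u, v) \<in> F" "(v, u) \<in> F'"
proof -
  obtain d d' where d: "d \<in> F" "d' \<in> F'" "dart_edge d = dart_edge d'"
    using adj unfolding adjacent_faces_def by blast
  \<comment> \<open>Distinct faces are distinct orbits, so they have no dart in common.\<close>
  have "d \<noteq> d'"
    using adj face_eq_orbit[OF assms(1-3) d(1)] face_eq_orbit[OF assms(1,2,4) d(2)]
    by (auto simp: adjacent_faces_def)
  then have "d' = (snd d, fst d)"
    using d(3) by (cases d; cases d') (auto simp: dart_edge_def doubleton_eq_iff)
  with d that show thesis by (cases d) auto
qed

lemma card_nbrs_cubic:
  assumes "cubic G" "v \<in> pverts G"
  shows "card (nbrs G v) = 3"
proof -
  have "out_arcs G v = Pair v ` nbrs G v" by (auto simp: out_arcs_def nbrs_def)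
  then have "out_degree G v = card (nbrs G v)"
    by (simp add: out_degree_def card_image inj_on_def)
  then show ?thesis using assms by (simp add: cubic_def)
qed

lemma rot_neq_self:
  assumes "rotation_system G rot" "v \<in> pverts G" "u \<in> nbrs G v" "card (nbrs G v) \<noteq> 1"
  shows "rot v u \<noteq> u"
proof
  assume "rot v u = u"
  then have "orbit (rot v) u = {u}" by (simp add: orbit_eq_singleton_iff)
  moreover have "orbit (rot v) u = nbrs G v"
    using assms(1-3) by (auto simp: rotation_system_def intro!: orbit_cyclic_eq3)
  ultimately show False using assms(4) by (metis is_singletonI is_singleton_altdef)
qed

theorem theorem31:
  fixes G :: "'a pair_pre_digraph" and rot :: "'a rotation" and \<mu>' :: "'a coloring"
  assumes "pair_graph G" and "Digraph_Component.connected G" and "cubic G" and "girth G = 4"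
    and "Pi_map G rot"
    and "etgc G \<mu>'" and "periodic G rot \<mu>'" and "spray_rule G \<mu>'"
  shows "\<exists>\<mu>. associated_face_coloring G rot \<mu>' \<mu> \<and>
           (\<forall>F \<in> faces G rot. \<forall>F' \<in> faces G rot. adjacent_faces F F' \<longrightarrow> \<mu> F \<noteq> \<mu> F')"
proof (intro exI conjI ballI impI)
  note G = assms(1) and per = assms(7)
  have rot: "rotation_system G rot"
    using assms(5) by (simp add: Pi_map_def Y_map_def graph_map_def embeds_in_genus_def)
  show "associated_face_coloring G rot \<mu>' (face_word rot \<mu>')"
    by (rule associated_face_coloring_face_word[OF G rot per])
  fix F F' assume F: "F \<in> faces G rot" and F': "F' \<in> faces G rot" and adj: "adjacent_faces F F'"
  obtain u v where uv: "(u, v) \<in> F" and vu: "(v, u) \<in> F'"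
    by (rule adjacent_faces_opposite_darts[OF G rot F F' adj])
  define w where "w = rot u v"
  have uw: "(u, w) \<in> F'"
    using cyclic_on_inI[OF cyclic_on_face[OF G rot F'] vu] by (simp add: face_step_def w_def)
  have u: "u \<in> pverts G"
    using face_subset_parcs[OF G rot F'] vu by (blast intro: dart_end_in_pverts[OF G])
  have nbrs: "v \<in> nbrs G u" "w \<in> nbrs G u"
    using face_subset_parcs[OF G rot] F F' uv uw by (auto simp: nbrs_def)
  have "w \<noteq> v"
    unfolding w_def using rot_neq_self[OF rot u nbrs(1)] card_nbrs_cubic[OF assms(3) u] by simp
  moreover have "inj_on (vcol \<mu>') (closed_nbrs G u)"
    using assms(6) u by (simp add: etgc_def etc_def bij_betw_def)
  ultimately have "vcol \<mu>' v \<noteq> vcol \<mu>' w"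
    using nbrs by (auto simp: closed_nbrs_def dest: inj_onD)
  then show "face_word rot \<mu>' F \<noteq> face_word rot \<mu>' F'"
    using face_word_determines_successor[OF G rot per F uv F' uw] by auto
qed

end
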